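(* Fix $\theta\in\mathcal B$ with $C^\theta\ge0$. Suppose branching covers every original option remaining after the integer-safe within-item dominance rule, and suppose a node is pruned only when it is infeasible or when its valid residual LP upper bound is no larger than the incumbent value. If every live node is eventually fathomed, then the returned incumbent is optimal for the fixed-$\theta$ MCKP.
   Context: Data. There are items $i=1,\dots,n$. Item $i$ has a finite price menu $\mathcal X_i=\{x_{i,1},\dots,x_{i,m}\}\subset\mathbb R$, a reference price $a_i>0$, an exposure $\omega_i>0$, a nominal demand function $\hat g_i:\mathcal X_i\to\mathbb R_{>0}$ (monotone decreasing on the admissible range), and a relative tolerance $\sigma_i$. A margin target $\Delta>0$ and an integer budget $\Gamma\in\{0,1,\dots,n\}$ are given. The admissible menu $\mathcal X_i^{\mathrm{ad}}=\mathcal X_i\cap[(1-\sigma_i)a_i,(1+\sigma_i)a_i]$ is assumed nonempty. A variability parameter $\delta_i(x_i)$ is given with $0\le\delta_i(x_i)<\hat g_i(x_i)$ on $\mathcal X_i^{\mathrm{ad}}$. All option indices $j$ below range over admissible ("original") options of item $i$. Arithmetic is exact. Fixed-$\theta$ MCKP. Put $v_{ij}=\omega_i x_{i,j}\hat g_i(x_{i,j})$, $s_{ij}=\omega_i(x_{i,j}-\Delta a_i)\hat g_i(x_{i,j})$, $t_{ij}=\omega_i(x_{i,j}-\Delta a_i)\delta_i(x_{i,j})$, and $\mathcal B=\{0\}\cup\{|t_{ij}|: x_{i,j}\in\mathcal X_i^{\mathrm{ad}}\}$. For $\theta\in\mathcal B$ let $s^\theta_{ij}=s_{ij}-\max\{0,|t_{ij}|-\theta\}$,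 choose $j^\theta(i)\in\arg\max_j s^\theta_{ij}$, and set $c^\theta_{ij}=s^\theta_{i,j^\theta(i)}-s^\theta_{ij}\ge0$ and $C^\theta=\sum_i s^\theta_{i,j^\theta(i)}-\Gamma\theta$. The fixed-$\theta$ MCKP is: choose one option $j(i)$ per item to maximize $\sum_i v_{i,j(i)}$ subject to $\sum_i c^\theta_{i,j(i)}\le C^\theta$. Integer-safe within-item dominance rule. An original option may be removed from the search only if another option of the same item has weakly smaller cost $c^\theta$ and weakly larger value $v$, with at least one strict inequality. Branch-and-bound. A node fixes options for a subset $F$ of the items and leaves $U=\{1,\dots,n\}\setminus F$ free; the root has $F=\emptyset$. An integer completion of a node is a choice of one option for every item that agrees with the node on $F$ and satisfies the capacity constraint. If the fixed items use cost $C_F$ and contribute value $V_F$, the residual LP upper bound of the node is $V_F$ plus the optimal value of the LP relaxation of the MCKP restricted to the items of $U$ with capacity $C^\theta-C_F$; it is valid in that it is at least the value of every integer completion. A node is infeasible if it has no integer completion. Branching at a node selects a free item and creates one child for each remaining (not removed) option of that item. The incumbent is the best feasible complete selection found so far (value $-\infty$ if none); whenever a node with $U=\emptyset$ satisfies the capacity constraint its selection is compared with the incumbent. A live node is fathomed when it is pruned, or is a completely fixed node that has been evaluated, or has been branched on and all its children are fathomed. *)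

theory Defs
  imports Complex_Main "HOL-Library.Extended_Real"
begin

record pricing_data =
  n_items :: nat
  n_prices :: nat
  price :: "nat \<Rightarrow> nat \<Rightarrow> real"
  ref_price :: "nat \<Rightarrow> real"
  exposure :: "nat \<Rightarrow> real"
  demand :: "nat \<Rightarrow> real \<Rightarrow> real"
  tolerance :: "nat \<Rightarrow> real"
  margin :: real
  budget :: nat
  variability :: "nat \<Rightarrow> real \<Rightarrow> real"

definition items :: "pricing_data \<Rightarrow> nat set" where
  "items D = {1..n_items D}"

definition menu :: "pricing_data \<Rightarrow> nat \<Rightarrow> real set" where
  "menu D i = price D i ` {1..n_prices D}"

definition adm_menu :: "pricing_data \<Rightarrow> nat \<Rightarrow> real set" where
  "adm_menu D i = menu D i \<inter>
     {(1 - tolerance D i) * ref_price D i .. (1 + tolerance D i) * ref_price D i}"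

definition options :: "pricing_data \<Rightarrow> nat \<Rightarrow> nat set" where
  "options D i = {j \<in> {1..n_prices D}. price D i j \<in> adm_menu D i}"

definition valid_data :: "pricing_data \<Rightarrow> bool" where
  "valid_data D \<longleftrightarrow>
     margin D > 0 \<and> budget D \<le> n_items D \<and>
     (\<forall>i\<in>items D.
        ref_price D i > 0 \<and> exposure D i > 0 \<and>
        (\<forall>p\<in>menu D i. demand D i p > 0) \<and>
        monotone_on (adm_menu D i) (\<le>) (\<ge>) (demand D i) \<and>
        adm_menu D i \<noteq> {} \<and>
        (\<forall>p\<in>adm_menu D i. 0 \<le> variability D i p \<and> variability D i p < demand D i p))"

definition v_coef :: "pricing_data \<Rightarrow> nat \<Rightarrow> nat \<Rightarrow> real" where
  "v_coef D i j = exposure D i * price D i j * demand D i (price D i j)"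

definition s_coef :: "pricing_data \<Rightarrow> nat \<Rightarrow> nat \<Rightarrow> real" where
  "s_coef D i j =
     exposure D i * (price D i j - margin D * ref_price D i) * demand D i (price D i j)"

definition t_coef :: "pricing_data \<Rightarrow> nat \<Rightarrow> nat \<Rightarrow> real" where
  "t_coef D i j =
     exposure D i * (price D i j - margin D * ref_price D i) * variability D i (price D i j)"

definition breakpoints :: "pricing_data \<Rightarrow> real set" where
  "breakpoints D = {0} \<union> {\<bar>t_coef D i j\<bar> | i j. i \<in> items D \<and> j \<in> options D i}"

definition s_theta :: "pricing_data \<Rightarrow> real \<Rightarrow> nat \<Rightarrow> nat \<Rightarrow> real" where
  "s_theta D \<theta> i j = s_coef D i j - max 0 (\<bar>t_coef D i j\<bar> - \<theta>)"

text \<open>The parameter \<open>js\<close> is the choice of a maximizer of \<^const>\<open>s_theta\<close> for each item.\<close>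

definition argmax_choice :: "pricing_data \<Rightarrow> real \<Rightarrow> (nat \<Rightarrow> nat) \<Rightarrow> bool" where
  "argmax_choice D \<theta> js \<longleftrightarrow>
     (\<forall>i\<in>items D. is_arg_max (s_theta D \<theta> i) (\<lambda>j. j \<in> options D i) (js i))"

definition c_theta :: "pricing_data \<Rightarrow> real \<Rightarrow> (nat \<Rightarrow> nat) \<Rightarrow> nat \<Rightarrow> nat \<Rightarrow> real" where
  "c_theta D \<theta> js i j = s_theta D \<theta> i (js i) - s_theta D \<theta> i j"

definition capacity :: "pricing_data \<Rightarrow> real \<Rightarrow> (nat \<Rightarrow> nat) \<Rightarrow> real" where
  "capacity D \<theta> js = (\<Sum>i\<in>items D. s_theta D \<theta> i (js i)) - real (budget D) * \<theta>"

text \<open>A node is a partial assignment of options to items. Its domain is the set of fixed items;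
  a complete selection is a node whose domain is the set of all items.\<close>

type_synonym node = "nat \<rightharpoonup> nat"

definition fixed_cost :: "pricing_data \<Rightarrow> real \<Rightarrow> (nat \<Rightarrow> nat) \<Rightarrow> node \<Rightarrow> real" where
  "fixed_cost D \<theta> js N = (\<Sum>i\<in>dom N. c_theta D \<theta> js i (the (N i)))"

definition fixed_value :: "pricing_data \<Rightarrow> node \<Rightarrow> real" where
  "fixed_value D N = (\<Sum>i\<in>dom N. v_coef D i (the (N i)))"

definition mckp_feasible :: "pricing_data \<Rightarrow> real \<Rightarrow> (nat \<Rightarrow> nat) \<Rightarrow> node \<Rightarrow> bool" where
  "mckp_feasible D \<theta> js S \<longleftrightarrow>
     dom S = items D \<and> (\<forall>i\<in>items D. the (S i) \<in> options D i) \<and>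
     fixed_cost D \<theta> js S \<le> capacity D \<theta> js"

definition mckp_optimal :: "pricing_data \<Rightarrow> real \<Rightarrow> (nat \<Rightarrow> nat) \<Rightarrow> node \<Rightarrow> bool" where
  "mckp_optimal D \<theta> js S \<longleftrightarrow> is_arg_max (fixed_value D) (mckp_feasible D \<theta> js) S"

definition dominates ::
  "pricing_data \<Rightarrow> real \<Rightarrow> (nat \<Rightarrow> nat) \<Rightarrow> nat \<Rightarrow> nat \<Rightarrow> nat \<Rightarrow> bool" where
  "dominates D \<theta> js i j' j \<longleftrightarrow>
     c_theta D \<theta> js i j' \<le> c_theta D \<theta> js i j \<and> v_coef D i j \<le> v_coef D i j' \<and>
     (c_theta D \<theta> js i j' < c_theta D \<theta> js i j \<or> v_coef D i j < v_coef D i j')"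

text \<open>\<open>R i\<close> is the set of options of item \<open>i\<close> that have not been removed. The dominating
  option has to be an original one, but may itself have been removed.\<close>

definition integer_safe_removal ::
  "pricing_data \<Rightarrow> real \<Rightarrow> (nat \<Rightarrow> nat) \<Rightarrow> (nat \<Rightarrow> nat set) \<Rightarrow> bool" where
  "integer_safe_removal D \<theta> js R \<longleftrightarrow>
     (\<forall>i\<in>items D. R i \<subseteq> options D i \<and>
        (\<forall>j\<in>options D i - R i. \<exists>j'\<in>options D i - {j}. dominates D \<theta> js i j' j))"

definition integer_completion ::
  "pricing_data \<Rightarrow> real \<Rightarrow> (nat \<Rightarrow> nat) \<Rightarrow> node \<Rightarrow> node \<Rightarrow> bool" where
  "integer_completion D \<theta> js N S \<longleftrightarrow> N \<subseteq>\<^sub>m S \<and> mckp_feasible D \<theta> js S"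

definition infeasible_node :: "pricing_data \<Rightarrow> real \<Rightarrow> (nat \<Rightarrow> nat) \<Rightarrow> node \<Rightarrow> bool" where
  "infeasible_node D \<theta> js N \<longleftrightarrow> (\<nexists>S. integer_completion D \<theta> js N S)"

definition lp_feasible ::
  "pricing_data \<Rightarrow> real \<Rightarrow> (nat \<Rightarrow> nat) \<Rightarrow> nat set \<Rightarrow> real \<Rightarrow> (nat \<Rightarrow> nat \<Rightarrow> real) \<Rightarrow> bool" where
  "lp_feasible D \<theta> js U cap y \<longleftrightarrow>
     (\<forall>i\<in>U. (\<forall>j\<in>options D i. 0 \<le> y i j) \<and> (\<Sum>j\<in>options D i. y i j) = 1) \<and>
     (\<Sum>i\<in>U. \<Sum>j\<in>options D i. c_theta D \<theta> js i j * y i j) \<le> cap"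

text \<open>The supremum is taken in the extended reals, so an infeasible linear program has
  value \<open>-\<infinity>\<close>.\<close>

definition lp_value ::
  "pricing_data \<Rightarrow> real \<Rightarrow> (nat \<Rightarrow> nat) \<Rightarrow> nat set \<Rightarrow> real \<Rightarrow> ereal" where
  "lp_value D \<theta> js U cap =
     (SUP y \<in> {y. lp_feasible D \<theta> js U cap y}.
        ereal (\<Sum>i\<in>U. \<Sum>j\<in>options D i. v_coef D i j * y i j))"

definition residual_lp_bound ::
  "pricing_data \<Rightarrow> real \<Rightarrow> (nat \<Rightarrow> nat) \<Rightarrow> node \<Rightarrow> ereal" where
  "residual_lp_bound D \<theta> js N =
     ereal (fixed_value D N) +
     lp_value D \<theta> js (items D - dom N) (capacity D \<theta> js - fixed_cost D \<theta> js N)"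

definition incumbent_value :: "pricing_data \<Rightarrow> node option \<Rightarrow> ereal" where
  "incumbent_value D inc = (case inc of None \<Rightarrow> -\<infinity> | Some S \<Rightarrow> ereal (fixed_value D S))"

text \<open>The comparison of a complete selection \<open>S\<close> with the incumbent \<open>inc\<close>, with result
  \<open>inc'\<close>. Ties may be broken either way.\<close>

definition compare_incumbent ::
  "pricing_data \<Rightarrow> real \<Rightarrow> (nat \<Rightarrow> nat) \<Rightarrow> node \<Rightarrow> node option \<Rightarrow> node option \<Rightarrow> bool" where
  "compare_incumbent D \<theta> js S inc inc' \<longleftrightarrow>
     (if mckp_feasible D \<theta> js S
      then inc' \<in> {inc, Some S} \<and>
           incumbent_value D inc' = max (incumbent_value D inc) (ereal (fixed_value D S))
      else inc' = inc)"

text \<open>\<open>live\<close> contains all nodes created so far, whether or not they have been processed.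
  \<open>branch_item\<close> maps each node that has been branched on to the selected item.\<close>

record bb_state =
  live :: "node set"
  pruned :: "node set"
  evaluated :: "node set"
  branch_item :: "node \<rightharpoonup> nat"
  incumbent :: "node option"

definition bb_init :: bb_state where
  "bb_init = \<lparr>live = {Map.empty}, pruned = {}, evaluated = {}, branch_item = Map.empty,
              incumbent = None\<rparr>"

definition unprocessed :: "bb_state \<Rightarrow> node set" where
  "unprocessed st = live st - pruned st - evaluated st - dom (branch_item st)"

definition children :: "(nat \<Rightarrow> nat set) \<Rightarrow> node \<Rightarrow> nat \<Rightarrow> node set" where
  "children R N i = {N(i \<mapsto> j) | j. j \<in> R i}"

text \<open>Pruning is unconstrained in this relation; the pruning criterion is imposed on runs by
  \<open>valid_pruning\<close> below. The last rule covers feasible selections found by other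
  means than evaluating a node, such as a warm start or a heuristic.\<close>

inductive bb_step ::
  "pricing_data \<Rightarrow> real \<Rightarrow> (nat \<Rightarrow> nat) \<Rightarrow> (nat \<Rightarrow> nat set) \<Rightarrow> bb_state \<Rightarrow> bb_state \<Rightarrow> bool"
  for D :: pricing_data and \<theta> :: real and js :: "nat \<Rightarrow> nat" and R :: "nat \<Rightarrow> nat set"
where
  prune: "N \<in> unprocessed st \<Longrightarrow>
    bb_step D \<theta> js R st (st\<lparr>pruned := insert N (pruned st)\<rparr>)"
| evaluate: "N \<in> unprocessed st \<Longrightarrow> dom N = items D \<Longrightarrow>
    compare_incumbent D \<theta> js N (incumbent st) inc' \<Longrightarrow>
    bb_step D \<theta> js R st (st\<lparr>evaluated := insert N (evaluated st), incumbent := inc'\<rparr>)"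
| branch: "N \<in> unprocessed st \<Longrightarrow> i \<in> items D - dom N \<Longrightarrow>
    bb_step D \<theta> js R st
      (st\<lparr>live := live st \<union> children R N i, branch_item := (branch_item st)(N \<mapsto> i)\<rparr>)"
| found: "mckp_feasible D \<theta> js S \<Longrightarrow>
    compare_incumbent D \<theta> js S (incumbent st) inc' \<Longrightarrow>
    bb_step D \<theta> js R st (st\<lparr>incumbent := inc'\<rparr>)"

definition bb_run ::
  "pricing_data \<Rightarrow> real \<Rightarrow> (nat \<Rightarrow> nat) \<Rightarrow> (nat \<Rightarrow> nat set) \<Rightarrow> (nat \<Rightarrow> bb_state) \<Rightarrow> nat \<Rightarrow> bool" where
  "bb_run D \<theta> js R run T \<longleftrightarrow>
     run 0 = bb_init \<and> (\<forall>k<T. bb_step D \<theta> js R (run k) (run (Suc k)))"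

text \<open>The incumbent in the criterion is the one at the time of pruning, not the final one.\<close>

definition valid_pruning ::
  "pricing_data \<Rightarrow> real \<Rightarrow> (nat \<Rightarrow> nat) \<Rightarrow> (nat \<Rightarrow> bb_state) \<Rightarrow> nat \<Rightarrow> bool" where
  "valid_pruning D \<theta> js run T \<longleftrightarrow>
     (\<forall>k<T. \<forall>N \<in> pruned (run (Suc k)) - pruned (run k).
        infeasible_node D \<theta> js N \<or>
        residual_lp_bound D \<theta> js N \<le> incumbent_value D (incumbent (run k)))"

inductive fathomed :: "(nat \<Rightarrow> nat set) \<Rightarrow> bb_state \<Rightarrow> node \<Rightarrow> bool"
  for R :: "nat \<Rightarrow> nat set" and st :: bb_state
where
  "N \<in> pruned st \<Longrightarrow> fathomed R st N"
| "N \<in> evaluated st \<Longrightarrow> fathomed R st N"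
| "branch_item st N = Some i \<Longrightarrow> (\<And>N'. N' \<in> children R N i \<Longrightarrow> fathomed R st N') \<Longrightarrow>
     fathomed R st N"

end

theory Submission
  imports Defs
begin

text \<open>
  The argument follows one good selection through the search tree.

  Removal costs nothing: for every option there is a remaining option that is no more costly and
  no less valuable. The dominating option offered by the removal rule may itself have been removed,
  but a dominator has strictly smaller cost minus value, so among the finitely many
  options that are at least as good as a given one, a minimizer of that difference has not been
  removed (\<open>remaining_option_at_least_as_good\<close>). Replacing options item by item turns any
  feasible selection into a feasible selection \<open>S\<close> that uses remaining options only and has at
  least the same value (\<open>remaining_selection_at_least_as_good\<close>).

  Such an \<open>S\<close> cannot be lost. It extends the root, and whenever it extends a node that is
  branched on, it extends one of the children, because its option of the
  branching item is remaining. Descending along the derivation that the root is fathomed, one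
  therefore reaches a node below which \<open>S\<close> lies and which is pruned or evaluated
  (\<open>incumbent_ge_selection_below_fathomed_node\<close>). In the first case the node is not infeasible,
  so the value of \<open>S\<close> is at most its LP bound (\<open>selection_value_le_residual_lp_bound\<close>), which is
  at most the incumbent value at that time; in the second case the node is \<open>S\<close> itself and was
  compared with the incumbent. Since incumbent values never decrease, the final incumbent is at
  least as good as \<open>S\<close>, hence as every feasible selection.

  Finally, the choice of the options \<open>js i\<close> has cost zero and is feasible because the capacity is
  nonnegative. So the final incumbent value is not \<open>-\<infinity>\<close>, and an incumbent exists.
\<close>

section \<open>Dominated options can be replaced by remaining ones\<close>

lemma finite_items [simp]: "finite (items D)"
  by (simp add: items_def)

lemma finite_options_of_item [simp]: "finite (options D i)"
  by (simp add: options_def)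

lemma remaining_option_at_least_as_good:
  assumes "integer_safe_removal D \<theta> js R" "i \<in> items D" "j \<in> options D i"
  shows "\<exists>r\<in>R i. c_theta D \<theta> js i r \<le> c_theta D \<theta> js i j \<and> v_coef D i j \<le> v_coef D i r"
proof -
  let ?A = "{r \<in> options D i. c_theta D \<theta> js i r \<le> c_theta D \<theta> js i j \<and> v_coef D i j \<le> v_coef D i r}"
  let ?f = "\<lambda>r. c_theta D \<theta> js i r - v_coef D i r"
  have fin: "finite ?A" and ne: "?A \<noteq> {}" using assms(3) by auto
  obtain r where "is_arg_min ?f (\<lambda>x. x \<in> ?A) r"
    using ex_is_arg_min_if_finite[OF fin ne] by blast
  then have rA: "r \<in> ?A" and min: "\<And>x. x \<in> ?A \<Longrightarrow> \<not> ?f x < ?f r"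
    unfolding is_arg_min_def by blast+
  have "r \<in> R i"
  proof (rule ccontr)
    assume "r \<notin> R i"
    then obtain x where "x \<in> options D i" "dominates D \<theta> js i x r"
      using assms(1,2) rA unfolding integer_safe_removal_def by blast
    \<comment> \<open>By transitivity a dominator of \<open>r\<close> is a competitor of \<open>r\<close> in the minimization.\<close>
    then have "x \<in> ?A" "?f x < ?f r" using rA by (auto simp: dominates_def)
    then show False using min by blast
  qed
  then show ?thesis using rA by blast
qed

lemma remaining_selection_at_least_as_good:
  assumes "integer_safe_removal D \<theta> js R" "mckp_feasible D \<theta> js S"
  shows "\<exists>S'. mckp_feasible D \<theta> js S' \<and> (\<forall>i\<in>items D. the (S' i) \<in> R i) \<and>
    fixed_value D S \<le> fixed_value D S'"
proof -
  have "\<forall>i\<in>items D. \<exists>r. r \<in> R i \<and> c_theta D \<theta> js i r \<le> c_theta D \<theta> js i (the (S i)) \<and>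
      v_coef D i (the (S i)) \<le> v_coef D i r"
    using remaining_option_at_least_as_good[OF assms(1)] assms(2)
    unfolding mckp_feasible_def by blast
  then obtain r where r: "r i \<in> R i" "c_theta D \<theta> js i (r i) \<le> c_theta D \<theta> js i (the (S i))"
      "v_coef D i (the (S i)) \<le> v_coef D i (r i)" if "i \<in> items D" for i
    by metis
  define S' where "S' i = (if i \<in> items D then Some (r i) else None)" for i
  have dom: "dom S' = items D" by (auto simp: S'_def dom_def)
  have domS: "dom S = items D" using assms(2) by (simp add: mckp_feasible_def)
  have "fixed_cost D \<theta> js S' \<le> fixed_cost D \<theta> js S"
    unfolding fixed_cost_def dom domS using r(2) by (intro sum_mono) (simp add: S'_def)
  moreover have "fixed_value D S \<le> fixed_value D S'"
    unfolding fixed_value_def dom domS using r(3) by (intro sum_mono) (simp add: S'_def)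
  moreover have "\<forall>i\<in>items D. the (S' i) \<in> R i" using r(1) by (simp add: S'_def)
  moreover from this have "\<forall>i\<in>items D. the (S' i) \<in> options D i"
    using assms(1) unfolding integer_safe_removal_def by blast
  ultimately show ?thesis
    using assms(2) dom unfolding mckp_feasible_def by (intro exI[of _ S']) auto
qed

section \<open>Validity of the residual LP bound\<close>

lemma sum_split_extended_node:
  fixes f :: "nat \<Rightarrow> nat \<Rightarrow> real"
  assumes "N \<subseteq>\<^sub>m S" "finite (dom S)"
  shows "(\<Sum>i\<in>dom S. f i (the (S i))) =
    (\<Sum>i\<in>dom N. f i (the (N i))) + (\<Sum>i\<in>dom S - dom N. f i (the (S i)))"
proof -
  have "(\<Sum>i\<in>dom N. f i (the (S i))) = (\<Sum>i\<in>dom N. f i (the (N i)))"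
    using assms(1) by (intro sum.cong) (auto simp: map_le_def)
  then show ?thesis
    using sum.subset_diff[OF map_le_implies_dom_le[OF assms(1)] assms(2), of "\<lambda>i. f i (the (S i))"]
    by simp
qed

text \<open>The indicator of \<open>S\<close> on the free items is a feasible point of the residual linear program,
  and its objective value is the value that \<open>S\<close> collects there.\<close>

lemma selection_value_le_residual_lp_bound:
  assumes "integer_completion D \<theta> js N S"
  shows "ereal (fixed_value D S) \<le> residual_lp_bound D \<theta> js N"
proof -
  have le: "N \<subseteq>\<^sub>m S" and feas: "mckp_feasible D \<theta> js S"
    using assms by (auto simp: integer_completion_def)
  have dom: "dom S = items D" and opt: "\<And>i. i \<in> items D \<Longrightarrow> the (S i) \<in> options D i"
    and cap: "fixed_cost D \<theta> js S \<le> capacity D \<theta> js"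
    using feas by (auto simp: mckp_feasible_def)
  have split: "(\<Sum>i\<in>dom S. f i (the (S i))) =
      (\<Sum>i\<in>dom N. f i (the (N i))) + (\<Sum>i\<in>items D - dom N. f i (the (S i)))"
    for f :: "nat \<Rightarrow> nat \<Rightarrow> real"
    using sum_split_extended_node[OF le, of f] dom by simp
  define y :: "nat \<Rightarrow> nat \<Rightarrow> real" where "y i j = (if j = the (S i) then 1 else 0)" for i j
  have pick: "(\<Sum>i\<in>items D - dom N. \<Sum>j\<in>options D i. f i j * y i j) =
      (\<Sum>i\<in>items D - dom N. f i (the (S i)))" for f :: "nat \<Rightarrow> nat \<Rightarrow> real"
    using opt by (intro sum.cong) (auto simp: y_def if_distrib[of "(*) _"] sum.delta cong: if_cong)
  have "(\<Sum>j\<in>options D i. y i j) = 1" if "i \<in> items D" for i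
    using opt[OF that] by (simp add: y_def)
  then have "lp_feasible D \<theta> js (items D - dom N) (capacity D \<theta> js - fixed_cost D \<theta> js N) y"
    using cap split[of "c_theta D \<theta> js"] pick[of "c_theta D \<theta> js"]
    by (auto simp: lp_feasible_def fixed_cost_def) (auto simp: y_def)
  then have "ereal (\<Sum>i\<in>items D - dom N. \<Sum>j\<in>options D i. v_coef D i j * y i j) \<le>
      lp_value D \<theta> js (items D - dom N) (capacity D \<theta> js - fixed_cost D \<theta> js N)"
    unfolding lp_value_def by (intro SUP_upper) simp
  then have "ereal (fixed_value D N) + ereal (\<Sum>i\<in>items D - dom N. v_coef D i (the (S i))) \<le>
      residual_lp_bound D \<theta> js N"
    unfolding residual_lp_bound_def pick by (rule add_left_mono)
  then show ?thesis
    using split[of "v_coef D"] by (simp add: fixed_value_def)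
qed

section \<open>Invariants of a branch-and-bound run\<close>

lemma incumbent_value_step_mono:
  assumes "bb_step D \<theta> js R st st'"
  shows "incumbent_value D (incumbent st) \<le> incumbent_value D (incumbent st')"
  using assms by cases (auto simp: compare_incumbent_def split: if_splits)

lemma incumbent_value_run_mono:
  assumes "bb_run D \<theta> js R run T" "k \<le> l" "l \<le> T"
  shows "incumbent_value D (incumbent (run k)) \<le> incumbent_value D (incumbent (run l))"
  using assms(2,3)
proof (induction l rule: dec_induct)
  case (step l)
  then have "bb_step D \<theta> js R (run l) (run (Suc l))"
    using assms(1) by (simp add: bb_run_def)
  then show ?case using step incumbent_value_step_mono order_trans by fastforce
qed simp

lemma incumbent_feasible:
  assumes "bb_run D \<theta> js R run T" "k \<le> T" "incumbent (run k) = Some S"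
  shows "mckp_feasible D \<theta> js S"
  using assms(2,3)
proof (induction k arbitrary: S)
  case 0
  then show ?case using assms(1) by (simp add: bb_run_def bb_init_def)
next
  case (Suc k)
  have "bb_step D \<theta> js R (run k) (run (Suc k))"
    using assms(1) Suc.prems by (simp add: bb_run_def)
  then show ?case
    using Suc by cases (auto simp: compare_incumbent_def split: if_splits)
qed

lemma branch_item_in_items:
  assumes "bb_run D \<theta> js R run T" "k \<le> T" "branch_item (run k) N = Some i"
  shows "i \<in> items D"
  using assms(2,3)
proof (induction k)
  case 0
  then show ?case using assms(1) by (simp add: bb_run_def bb_init_def)
next
  case (Suc k)
  have "bb_step D \<theta> js R (run k) (run (Suc k))"
    using assms(1) Suc.prems by (simp add: bb_run_def)
  then show ?case using Suc by cases (auto split: if_splits)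
qed

lemma evaluated_node_compared:
  assumes "bb_run D \<theta> js R run T" "k \<le> T" "N \<in> evaluated (run k)"
  shows "dom N = items D \<and> (mckp_feasible D \<theta> js N \<longrightarrow>
    ereal (fixed_value D N) \<le> incumbent_value D (incumbent (run k)))"
  using assms(2,3)
proof (induction k)
  case 0
  then show ?case using assms(1) by (simp add: bb_run_def bb_init_def)
next
  case (Suc k)
  have st: "bb_step D \<theta> js R (run k) (run (Suc k))"
    using assms(1) Suc.prems by (simp add: bb_run_def)
  show ?case
  proof (cases "N \<in> evaluated (run k)")
    case True
    then show ?thesis using Suc incumbent_value_step_mono[OF st] order_trans by fastforce
  next
    case False
    from st show ?thesis
      using Suc.prems False by cases (auto simp: compare_incumbent_def split: if_splits)
  qed
qed

text \<open>The pruning criterion constrains the moment at which a node enters the pruned set, so that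
  moment has to be recovered from membership.\<close>

lemma pruned_at_some_step:
  assumes "bb_run D \<theta> js R run T" "N \<in> pruned (run k)"
  shows "\<exists>l<k. N \<in> pruned (run (Suc l)) - pruned (run l)"
  using assms(2)
proof (induction k)
  case 0
  then show ?case using assms(1) by (simp add: bb_run_def bb_init_def)
next
  case (Suc k)
  then show ?case by (cases "N \<in> pruned (run k)") (auto intro: less_SucI)
qed

lemma pruned_node_bounded:
  assumes "bb_run D \<theta> js R run T" "valid_pruning D \<theta> js run T" "k \<le> T"
    "N \<in> pruned (run k)" "integer_completion D \<theta> js N S"
  shows "ereal (fixed_value D S) \<le> incumbent_value D (incumbent (run k))"
proof -
  obtain l where l: "l < k" "N \<in> pruned (run (Suc l)) - pruned (run l)"
    using pruned_at_some_step[OF assms(1,4)] by blast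
  have "\<not> infeasible_node D \<theta> js N" using assms(5) by (auto simp: infeasible_node_def)
  then have "residual_lp_bound D \<theta> js N \<le> incumbent_value D (incumbent (run l))"
    using l assms(2,3) unfolding valid_pruning_def by (meson less_le_trans)
  also have "\<dots> \<le> incumbent_value D (incumbent (run k))"
    using incumbent_value_run_mono[OF assms(1)] l(1) assms(3) by simp
  finally show ?thesis
    using selection_value_le_residual_lp_bound[OF assms(5)] by (rule order_trans[rotated])
qed

section \<open>Optimality of the returned incumbent\<close>

text \<open>The induction follows the fathoming derivation down the tree: at a branched node, the child
  that fixes the branching item to the option of \<open>S\<close> is again extended by \<open>S\<close>.\<close>

lemma incumbent_ge_selection_below_fathomed_node:
  assumes "bb_run D \<theta> js R run T" "valid_pruning D \<theta> js run T" "k \<le> T"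
    and feas: "mckp_feasible D \<theta> js S" and rem: "\<forall>i\<in>items D. the (S i) \<in> R i"
    and "fathomed R (run k) N" "N \<subseteq>\<^sub>m S"
  shows "ereal (fixed_value D S) \<le> incumbent_value D (incumbent (run k))"
  using assms(6,7)
proof (induction rule: fathomed.induct)
  case (1 N)
  then show ?case
    using pruned_node_bounded[OF assms(1-3)] feas by (auto simp: integer_completion_def)
next
  case (2 N)
  have "dom N = dom S"
    using evaluated_node_compared[OF assms(1,3) 2(1)] feas by (simp add: mckp_feasible_def)
  then have "N = S"
    using 2(2) by (intro map_le_antisym) (auto simp: map_le_def)
  then show ?case using evaluated_node_compared[OF assms(1,3) 2(1)] feas by simp
next
  case (3 N i)
  have i: "i \<in> items D" using branch_item_in_items[OF assms(1,3) 3(1)] .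
  then have "i \<in> dom S" using feas by (simp add: mckp_feasible_def)
  then have "N(i \<mapsto> the (S i)) \<subseteq>\<^sub>m S" using 3(4) by (auto simp: map_le_def)
  moreover have "N(i \<mapsto> the (S i)) \<in> children R N i"
    using rem i by (auto simp: children_def)
  ultimately show ?case using 3(3) by blast
qed

lemma argmax_selection_feasible:
  assumes "argmax_choice D \<theta> js" "0 \<le> capacity D \<theta> js"
  shows "mckp_feasible D \<theta> js (\<lambda>i. if i \<in> items D then Some (js i) else None)"
proof -
  have "dom (\<lambda>i. if i \<in> items D then Some (js i) else None) = items D" by (auto simp: dom_def)
  then show ?thesis
    using assms by (simp add: mckp_feasible_def argmax_choice_def is_arg_max_def fixed_cost_def
        c_theta_def)
qed

theorem theorem11:
  fixes D :: pricing_data and \<theta> :: real and js :: "nat \<Rightarrow> nat"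
    and R :: "nat \<Rightarrow> nat set" and run :: "nat \<Rightarrow> bb_state" and T :: nat
  assumes "valid_data D"
    and "\<theta> \<in> breakpoints D"
    and "argmax_choice D \<theta> js"
    and "0 \<le> capacity D \<theta> js"
    and "integer_safe_removal D \<theta> js R"
    and "bb_run D \<theta> js R run T"
    and "valid_pruning D \<theta> js run T"
    and "\<forall>k\<le>T. \<forall>N\<in>live (run k). \<exists>k'. k \<le> k' \<and> k' \<le> T \<and> fathomed R (run k') N"
  shows "\<exists>S. incumbent (run T) = Some S \<and> mckp_optimal D \<theta> js S"
proof -
  note run = assms(6)
  have "Map.empty \<in> live (run 0)" using run by (simp add: bb_run_def bb_init_def)
  then obtain k where k: "k \<le> T" "fathomed R (run k) Map.empty" using assms(8) by blast
  have bound: "ereal (fixed_value D S) \<le> incumbent_value D (incumbent (run T))"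
    if S: "mckp_feasible D \<theta> js S" for S
  proof -
    obtain S' where S': "mckp_feasible D \<theta> js S'" "\<forall>i\<in>items D. the (S' i) \<in> R i"
        "fixed_value D S \<le> fixed_value D S'"
      using remaining_selection_at_least_as_good[OF assms(5) S] by blast
    have "ereal (fixed_value D S) \<le> ereal (fixed_value D S')" using S'(3) by simp
    also have "\<dots> \<le> incumbent_value D (incumbent (run k))"
      using incumbent_ge_selection_below_fathomed_node[OF run assms(7) k(1) S'(1,2) k(2)] by simp
    also have "\<dots> \<le> incumbent_value D (incumbent (run T))"
      using incumbent_value_run_mono[OF run k(1)] by simp
    finally show ?thesis .
  qed
  obtain S where S: "incumbent (run T) = Some S"
    using bound[OF argmax_selection_feasible[OF assms(3,4)]]
    by (cases "incumbent (run T)") (auto simp: incumbent_value_def)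
  have "mckp_feasible D \<theta> js S" using incumbent_feasible[OF run order_refl S] .
  moreover have "fixed_value D S' \<le> fixed_value D S" if "mckp_feasible D \<theta> js S'" for S'
    using bound[OF that] S by (simp add: incumbent_value_def)
  ultimately show ?thesis
    using S by (auto simp: mckp_optimal_def is_arg_max_def not_less)
qed

end
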